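(* Let $\mathbb{S}=(\mathbb{F}_q,+,\star)$ be a presemifield of even order $q$, and let $\mathcal{O}=\{(x,f(x)):x\in\mathbb{F}_q\}\cup\{(0),(\infty)\}$ be a hyperoval in $\Pi(\mathbb{S})$ with $f$ an additive permutation of $\mathbb{F}_q$, $f(0)=0$. Let $\mathcal{V}$ be the set of lines of $\Pi(\mathbb{S})$ not through $(\infty)$, let $\mathcal{U}(\mathcal{O})=\{\varphi(\mathcal{O}):\varphi\in\Sigma\}$, and let $\mathcal{B}=\{\mathrm{S}(\mathcal{O}')\setminus\mathscr{P}(\infty):\mathcal{O}'\in\mathcal{U}(\mathcal{O})\}$. Then the incidence structure $\mathcal{D}(\mathcal{O})$ with point set $\mathcal{V}$, block set $\mathcal{B}$, and incidence given by membership is a symmetric design with parameters $\left(q^2,\frac{q^2}{2}+\frac{q}{2},\frac{q^2}{4}+\frac{q}{2}\right)$. Furthermore, for $i=1,2$ the set $D_i$ of elements $g\in G_i$ with $g(l_{0,0})\in\mathrm{S}(\mathcal{O})\setminus\mathscr{P}(\infty)$ is a $\left(q^2,\frac{q^2}{2}+\frac{q}{2},\frac{q^2}{4}+\frac{q}{2}\right)$-difference set in $G_i$, and its complement $G_i\setminus D_i$ is a Hadamard difference set, i.e. a $\left(q^2,\frac{q^2}{2}-\frac{q}{2},\frac{q^2}{4}-\frac{q}{2}\right)$-difference set in $G_i$.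
   Context: A presemifield $(\mathbb{S},+,\star)$ of order $q$ is taken with underlying set $\mathbb{F}_q$, field addition, and a distributive multiplication $\star$ without zero divisors. The plane $\Pi(\mathbb{S})$ has affine points $(a,b)$, points at infinity $(a)$, $a\in\mathbb{F}_q\cup\{\infty\}$, and lines: the line at infinity; $l_a=\{(a,y):y\in\mathbb{F}_q\}\cup\{(\infty)\}$ for $a\in\mathbb{F}_q$; $l_{a,b}=\{(x,y):y=x\star a+b\}\cup\{(a)\}$. A hyperoval is a set of $q+2$ points no three collinear; $\mathrm{S}(\mathcal{O}')$ is the set of secant lines (lines meeting $\mathcal{O}'$ in two points) and $\mathscr{P}(\infty)$ is the set of lines through $(\infty)$. The translation $\tau_{a,b}$ maps $(x,y)\mapsto(x+a,y+b)$ and fixes all points at infinity; the shear $\sigma_c$ maps $(x,y)\mapsto(x,y+x\star c)$, $(z)\mapsto(z+c)$ for $z\in\mathbb{F}_q$, $(\infty)\mapsto(\infty)$. $\Sigma$ is the group generated by all $\tau_{a,b},\sigma_c$. $G_1=\{\tau_{0,b}\sigma_c: b,c\in\mathbb{F}_q\}$ and $G_2=\{\tau_{a,b}\sigma_a: a,b\in\mathbb{F}_q\}$ are subgroups of $\Sigma$ of order $q^2$ (composition $(\tau\sigma)(P)=\tau(\sigma(P))$). A $(v,k,\lambda)$-difference set in a group $G$ of order $v$ is a $k$-subset $D$ such that every non-identity element of $G$ can be written as $d_1d_2^{-1}$, $d_1,d_2\in D$, in exactly $\lambda$ ways. A symmetric $(v,k,\lambda)$ design has $v$ points and $v$ blocks,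 each block of size $k$, any two distinct blocks meeting in $\lambda$ points. *)

theory Defs
  imports "HOL-Library.Cardinality" "HOL-Algebra.Bij" "HOL-Algebra.Generated_Groups"
begin

text \<open>
  The field of order q is the type \<open>'a\<close>, of class \<open>{finite, field}\<close>, with q = \<open>CARD('a)\<close>.
  The addition of a presemifield is the addition of \<open>'a\<close>; only its multiplication is a parameter.
\<close>

definition presemifield :: "('a::{finite,field} \<Rightarrow> 'a \<Rightarrow> 'a) \<Rightarrow> bool" where
  "presemifield star \<longleftrightarrow>
     (\<forall>x y z. star (x + y) z = star x z + star y z) \<and>
     (\<forall>x y z. star x (y + z) = star x y + star x z) \<and>
     (\<forall>x y. star x y = 0 \<longrightarrow> x = 0 \<or> y = 0)"

text \<open>\<open>Slope a\<close> is the point at infinity (a) for a field element a; \<open>Infty\<close> is \<open>(\<infinity>)\<close>.\<close>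

datatype 'a point = Aff 'a 'a | Slope 'a | Infty

definition line_at_infinity :: "'a point set" where
  "line_at_infinity = range Slope \<union> {Infty}"

definition vertical_line :: "'a \<Rightarrow> 'a point set" where
  "vertical_line a = {Aff a y | y. True} \<union> {Infty}"

definition slope_line :: "('a::{finite,field} \<Rightarrow> 'a \<Rightarrow> 'a) \<Rightarrow> 'a \<Rightarrow> 'a \<Rightarrow> 'a point set" where
  "slope_line star a b = {Aff x y | x y. y = star x a + b} \<union> {Slope a}"

definition plane_lines :: "('a::{finite,field} \<Rightarrow> 'a \<Rightarrow> 'a) \<Rightarrow> 'a point set set" where
  "plane_lines star =
     {line_at_infinity} \<union> range vertical_line \<union> {slope_line star a b | a b. True}"

definition collinear3 ::
    "('a::{finite,field} \<Rightarrow> 'a \<Rightarrow> 'a) \<Rightarrow> 'a point \<Rightarrow> 'a point \<Rightarrow> 'a point \<Rightarrow> bool" where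
  "collinear3 star P Q R \<longleftrightarrow> (\<exists>l\<in>plane_lines star. P \<in> l \<and> Q \<in> l \<and> R \<in> l)"

definition hyperoval :: "('a::{finite,field} \<Rightarrow> 'a \<Rightarrow> 'a) \<Rightarrow> 'a point set \<Rightarrow> bool" where
  "hyperoval star H \<longleftrightarrow>
     card H = CARD('a) + 2 \<and>
     (\<forall>P\<in>H. \<forall>Q\<in>H. \<forall>R\<in>H. P \<noteq> Q \<and> P \<noteq> R \<and> Q \<noteq> R \<longrightarrow> \<not> collinear3 star P Q R)"

definition secants :: "('a::{finite,field} \<Rightarrow> 'a \<Rightarrow> 'a) \<Rightarrow> 'a point set \<Rightarrow> 'a point set set" where
  "secants star H = {l \<in> plane_lines star. card (l \<inter> H) = 2}"

definition lines_through_infty :: "('a::{finite,field} \<Rightarrow> 'a \<Rightarrow> 'a) \<Rightarrow> 'a point set set" where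
  "lines_through_infty star = {l \<in> plane_lines star. Infty \<in> l}"

fun translation :: "'a::{finite,field} \<Rightarrow> 'a \<Rightarrow> 'a point \<Rightarrow> 'a point" where
  "translation a b (Aff x y) = Aff (x + a) (y + b)"
| "translation a b (Slope z) = Slope z"
| "translation a b Infty = Infty"

fun shear :: "('a::{finite,field} \<Rightarrow> 'a \<Rightarrow> 'a) \<Rightarrow> 'a \<Rightarrow> 'a point \<Rightarrow> 'a point" where
  "shear star c (Aff x y) = Aff x (y + star x c)"
| "shear star c (Slope z) = Slope (z + c)"
| "shear star c Infty = Infty"

text \<open>
  In \<open>BijGroup UNIV\<close> the product of \<open>g\<close> and \<open>h\<close> is \<open>g \<circ> h\<close>, which is the composition
  convention used for \<open>G1\<close> and \<open>G2\<close>.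
\<close>

definition Sigma_group :: "('a::{finite,field} \<Rightarrow> 'a \<Rightarrow> 'a) \<Rightarrow> ('a point \<Rightarrow> 'a point) set" where
  "Sigma_group star =
     generate (BijGroup UNIV) ({translation a b | a b. True} \<union> range (shear star))"

definition G1 :: "('a::{finite,field} \<Rightarrow> 'a \<Rightarrow> 'a) \<Rightarrow> ('a point \<Rightarrow> 'a point) set" where
  "G1 star = {translation 0 b \<circ> shear star c | b c. True}"

definition G2 :: "('a::{finite,field} \<Rightarrow> 'a \<Rightarrow> 'a) \<Rightarrow> ('a point \<Rightarrow> 'a point) set" where
  "G2 star = {translation a b \<circ> shear star a | a b. True}"

abbreviation perm_group :: "('b \<Rightarrow> 'b) set \<Rightarrow> ('b \<Rightarrow> 'b) monoid" where
  "perm_group G \<equiv> (BijGroup UNIV)\<lparr>carrier := G\<rparr>"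

definition difference_set :: "('g, 'm) monoid_scheme \<Rightarrow> 'g set \<Rightarrow> nat \<Rightarrow> nat \<Rightarrow> nat \<Rightarrow> bool" where
  "difference_set G D v k l \<longleftrightarrow>
     group G \<and> finite (carrier G) \<and> order G = v \<and> D \<subseteq> carrier G \<and> card D = k \<and>
     (\<forall>g \<in> carrier G - {\<one>\<^bsub>G\<^esub>}.
        card {(d1, d2). d1 \<in> D \<and> d2 \<in> D \<and> g = d1 \<otimes>\<^bsub>G\<^esub> inv\<^bsub>G\<^esub> d2} = l)"

definition symmetric_design :: "'p set \<Rightarrow> 'p set set \<Rightarrow> nat \<Rightarrow> nat \<Rightarrow> nat \<Rightarrow> bool" where
  "symmetric_design V B v k l \<longleftrightarrow>
     finite V \<and> card V = v \<and> finite B \<and> card B = v \<and>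
     (\<forall>b\<in>B. b \<subseteq> V \<and> card b = k) \<and>
     (\<forall>b\<in>B. \<forall>b'\<in>B. b \<noteq> b' \<longrightarrow> card (b \<inter> b') = l)"

definition graph_oval :: "('a::{finite,field} \<Rightarrow> 'a) \<Rightarrow> 'a point set" where
  "graph_oval f = range (\<lambda>x. Aff x (f x)) \<union> {Slope 0, Infty}"

definition design_points :: "('a::{finite,field} \<Rightarrow> 'a \<Rightarrow> 'a) \<Rightarrow> 'a point set set" where
  "design_points star = {l \<in> plane_lines star. Infty \<notin> l}"

definition oval_orbit ::
    "('a::{finite,field} \<Rightarrow> 'a \<Rightarrow> 'a) \<Rightarrow> 'a point set \<Rightarrow> 'a point set set" where
  "oval_orbit star H = {\<phi> ` H | \<phi>. \<phi> \<in> Sigma_group star}"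

definition design_blocks ::
    "('a::{finite,field} \<Rightarrow> 'a \<Rightarrow> 'a) \<Rightarrow> 'a point set \<Rightarrow> 'a point set set set" where
  "design_blocks star H = {secants star H' - lines_through_infty star | H'. H' \<in> oval_orbit star H}"

definition secant_elements ::
    "('a::{finite,field} \<Rightarrow> 'a \<Rightarrow> 'a) \<Rightarrow> 'a point set \<Rightarrow> ('a point \<Rightarrow> 'a point) set
      \<Rightarrow> ('a point \<Rightarrow> 'a point) set" where
  "secant_elements star H G =
     {g \<in> G. g ` slope_line star 0 0 \<in> secants star H - lines_through_infty star}"

end

theory Submission
  imports Defs
begin

text \<open>
  Since \<open>f\<close> is additive, the line \<open>y = x \<star> m + k\<close> with \<open>m \<noteq> 0\<close> is a secant exactly if \<open>k\<close> lies in the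
  image of the additive map \<open>x \<mapsto> f x + x \<star> m\<close>, and the hyperoval property makes this image a
  subgroup of index 2. Hence the secants are described by a family of characters \<open>\<chi> m\<close> with values
  \<open>1\<close> and \<open>-1\<close>, where \<open>\<chi> 0\<close> is trivial because \<open>f\<close> is bijective. Counting points of the hyperoval
  on lines gives the column orthogonality \<open>\<Sum>m. \<chi> m d = 0\<close> for \<open>d \<noteq> 0\<close>, which forces row
  orthogonality. So \<open>(m, k) \<mapsto> \<chi> m k\<close> is a bent function: its autocorrelation vanishes off the
  origin. Elements of \<open>\<Sigma>\<close> act on lines so that, for the purpose of evaluating \<open>\<chi>\<close>, they only shift
  \<open>(m, k)\<close>, whence all intersection numbers.
\<close>

section \<open>Difference sets from regular permutation groups\<close>

lemma BijGroup_UNIV_mult: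
  "bij g \<Longrightarrow> bij h \<Longrightarrow> g \<otimes>\<^bsub>BijGroup UNIV\<^esub> h = g \<circ> h"
  by (auto simp: BijGroup_def Bij_def compose_def)

lemma BijGroup_UNIV_one: "\<one>\<^bsub>BijGroup UNIV\<^esub> = id"
  by (auto simp: BijGroup_def)

lemma BijGroup_UNIV_carrier: "carrier (BijGroup UNIV) = {g. bij g}"
  by (auto simp: BijGroup_def Bij_def)

text \<open>Reduces subgroup proofs to plain composition: a two-sided inverse inside
  \<open>G\<close> makes \<open>g\<close> bijective and is also its inverse in the group.\<close>

lemma subgroup_BijGroup_UNIV_I:
  assumes "G \<noteq> {}"
    and comp: "\<And>g h. g \<in> G \<Longrightarrow> h \<in> G \<Longrightarrow> g \<circ> h \<in> G"
    and inverse: "\<And>g. g \<in> G \<Longrightarrow> \<exists>h\<in>G. g \<circ> h = id \<and> h \<circ> g = id"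
  shows "subgroup G (BijGroup UNIV)"
proof -
  interpret group "BijGroup (UNIV :: 'a set)" by (rule group_BijGroup)
  have bij: "bij g" if "g \<in> G" for g
    using inverse[OF that] by (auto intro: o_bij)
  show ?thesis
  proof (rule subgroupI)
    show "G \<subseteq> carrier (BijGroup UNIV)" using bij by (auto simp: BijGroup_UNIV_carrier)
    show "G \<noteq> {}" by fact
    show "g \<otimes>\<^bsub>BijGroup UNIV\<^esub> h \<in> G" if "g \<in> G" "h \<in> G" for g h
      using that by (simp add: BijGroup_UNIV_mult bij comp)
    show "inv\<^bsub>BijGroup UNIV\<^esub> g \<in> G" if g: "g \<in> G" for g
    proof -
      obtain h where h: "h \<in> G" "g \<circ> h = id" "h \<circ> g = id" using inverse[OF g] by blast
      have "inv\<^bsub>BijGroup UNIV\<^esub> g = h"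
        by (rule inv_equality)
          (use g h bij in \<open>auto simp: BijGroup_UNIV_mult BijGroup_UNIV_one BijGroup_UNIV_carrier\<close>)
      then show ?thesis using h by simp
    qed
  qed
qed

lemma difference_set_regular_action:
  assumes sub: "subgroup G (BijGroup UNIV)"
    and reg: "bij_betw (\<lambda>g. g ` l) G V"
    and "finite V" and "B \<subseteq> V"
    and cnt: "\<And>g. g \<in> G \<Longrightarrow> g \<noteq> id \<Longrightarrow> card {m \<in> B. g ` m \<in> B} = lam"
  shows "difference_set (perm_group G) {g \<in> G. g ` l \<in> B} (card V) (card B) lam"
proof -
  interpret BG: group "BijGroup (UNIV :: 'a set)" by (rule group_BijGroup)
  let ?G = "perm_group G"
  let ?D = "{g \<in> G. g ` l \<in> B}"
  interpret G: group ?G by (rule BG.subgroup_imp_group[OF sub])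
  have bij: "bij g" if "g \<in> G" for g
    using subgroup.subset[OF sub] that by (auto simp: BijGroup_UNIV_carrier)
  have mult: "g \<otimes>\<^bsub>?G\<^esub> h = g \<circ> h" if "g \<in> G" "h \<in> G" for g h
    using that by (simp add: BijGroup_UNIV_mult bij)
  have one: "\<one>\<^bsub>?G\<^esub> = id" by (simp add: BijGroup_UNIV_one)
  have inj: "inj_on (\<lambda>g. g ` l) G" and img: "(\<lambda>g. g ` l) ` G = V"
    using reg by (auto simp: bij_betw_def)
  have fin: "finite G" using reg \<open>finite V\<close> bij_betw_finite by blast
  have "bij_betw (\<lambda>g. g ` l) ?D B"
    using inj img \<open>B \<subseteq> V\<close> by (auto simp: bij_betw_def inj_on_def)
  then have cardD: "card ?D = card B" by (rule bij_betw_same_card)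
  have "card {(d1, d2). d1 \<in> ?D \<and> d2 \<in> ?D \<and> g = d1 \<otimes>\<^bsub>?G\<^esub> inv\<^bsub>?G\<^esub> d2} = lam"
    if g: "g \<in> G" "g \<noteq> id" for g
  proof -
    have eq: "g = d1 \<otimes>\<^bsub>?G\<^esub> inv\<^bsub>?G\<^esub> d2 \<longleftrightarrow> d1 = g \<circ> d2" if "d1 \<in> G" "d2 \<in> G" for d1 d2
    proof -
      have "g = d1 \<otimes>\<^bsub>?G\<^esub> inv\<^bsub>?G\<^esub> d2 \<longleftrightarrow> d1 = g \<otimes>\<^bsub>?G\<^esub> d2"
        using G.inv_solve_right[of g d1 d2] g that by simp
      then show ?thesis using mult g that by metis
    qed
    have clos: "g \<circ> d \<in> G" if "d \<in> G" for d
      using G.m_closed[of g d] mult[OF g(1) that] g that by simp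
    let ?P = "{(d1, d2). d1 \<in> ?D \<and> d2 \<in> ?D \<and> g = d1 \<otimes>\<^bsub>?G\<^esub> inv\<^bsub>?G\<^esub> d2}"
    have P: "?P = (\<lambda>d. (g \<circ> d, d)) ` {d \<in> ?D. g ` d ` l \<in> B}"
    proof -
      have "?P = {(d1, d2). d1 \<in> ?D \<and> d2 \<in> ?D \<and> d1 = g \<circ> d2}"
        using eq by blast
      then show ?thesis using clos by (auto simp: image_comp)
    qed
    have "card ?P = card {d \<in> ?D. g ` d ` l \<in> B}"
      unfolding P by (rule card_image) (auto simp: inj_on_def)
    also have "\<dots> = card ((\<lambda>d. d ` l) ` {d \<in> ?D. g ` d ` l \<in> B})"
      by (rule card_image[symmetric]) (use inj in \<open>auto simp: inj_on_def\<close>)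
    also have "(\<lambda>d. d ` l) ` {d \<in> ?D. g ` d ` l \<in> B} = {m \<in> B. g ` m \<in> B}"
      using img \<open>B \<subseteq> V\<close> by auto
    finally show ?thesis using cnt[OF g] by simp
  qed
  moreover have "order ?G = card V"
    using bij_betw_same_card[OF reg] by (simp add: order_def)
  ultimately show ?thesis
    unfolding difference_set_def using fin cardD one G.is_group by simp
qed

section \<open>Characteristic two\<close>

text \<open>If \<open>1 + 1 \<noteq> 0\<close>, negation has no nonzero fixed point, so the pairs
  \<open>{y, - y}\<close> partition the nonzero elements and the field has odd order.\<close>

lemma even_card_field_char_two:
  fixes x :: "'a::{finite,field}"
  assumes "even CARD('a)"
  shows "x + x = 0"
proof (rule ccontr)
  assume "x + x \<noteq> 0"
  then have two: "(1::'a) + 1 \<noteq> 0" by (metis distrib_left mult.right_neutral mult_zero_right)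
  have ne: "- y \<noteq> y" if "y \<noteq> 0" for y :: 'a
  proof
    assume "- y = y"
    then have "(1 + 1) * y = 0" by (simp add: distrib_right)
    then show False using two that by simp
  qed
  let ?C = "(\<lambda>y::'a. {y, - y}) ` (UNIV - {0})"
  have "2 * card ?C = card (\<Union> ?C)"
  proof (rule card_partition)
    show "card c = 2" if "c \<in> ?C" for c
      using that ne by (metis (no_types, lifting) Diff_iff card_2_iff image_iff insertI1)
    show "c \<inter> d = {}" if C: "c \<in> ?C" "d \<in> ?C" and "c \<noteq> d" for c d
    proof -
      obtain y z where "c = {y, - y}" "d = {z, - z}" using C by blast
      then show ?thesis using \<open>c \<noteq> d\<close> by fastforce
    qed
  qed simp_all
  also have "\<Union> ?C = UNIV - {0::'a}" by auto
  also have "card \<dots> = CARD('a) - 1" by (simp add: card_Diff_singleton)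
  finally have "even (CARD('a) - 1)" by (metis dvd_triv_left)
  moreover obtain n where "CARD('a) = Suc n"
    using gr0_implies_Suc[OF zero_less_card_finite] by blast
  ultimately show False using assms by simp
qed

section \<open>Characters of an additive hyperoval\<close>

locale additive_hyperoval =
  fixes star :: "'a::{finite,field} \<Rightarrow> 'a \<Rightarrow> 'a" (infixl "\<star>" 70)
    and f :: "'a \<Rightarrow> 'a"
  assumes even_card: "even CARD('a)"
    and presemifield: "presemifield star"
    and bij_f: "bij f"
    and f_add: "f (x + y) = f x + f y"
    and hyperoval: "hyperoval star (graph_oval f)"
begin

lemma add_self: "x + x = (0::'a)"
  by (rule even_card_field_char_two[OF even_card])

lemma two_eq_0 [simp]: "(2::'a) = 0"
  using add_self[of 1] by simp

lemma add_self_left: "x + (x + y) = (y::'a)"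
  by (metis add_self add.assoc add_0)

lemma add_eq_iff: "x + y = z \<longleftrightarrow> x = z + (y::'a)"
  by (metis add_self_left add.commute)

lemma star_add_left: "(x + y) \<star> z = x \<star> z + y \<star> z"
  and star_add_right: "x \<star> (y + z) = x \<star> y + x \<star> z"
  and star_eq_0D: "x \<star> y = 0 \<Longrightarrow> x = 0 \<or> y = 0"
  using presemifield unfolding presemifield_def by blast+

lemma star_0_left [simp]: "0 \<star> x = 0"
  by (metis star_add_left add_self)

lemma star_0_right [simp]: "x \<star> 0 = 0"
  by (metis star_add_right add_self)

lemma f_0 [simp]: "f 0 = 0"
  by (metis f_add add_self)

lemma f_eq_0_iff: "f x = 0 \<longleftrightarrow> x = 0"
  using bij_f f_0 by (metis bij_pointE)

lemma bij_star_left: "x \<noteq> 0 \<Longrightarrow> bij (\<lambda>m. x \<star> m)"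
proof -
  assume x: "x \<noteq> 0"
  have "inj (\<lambda>m. x \<star> m)"
  proof (rule injI)
    fix m n assume "x \<star> m = x \<star> n"
    then have "x \<star> (m + n) = 0" by (simp add: star_add_right add_self)
    then have "m + n = 0" using star_eq_0D x by blast
    then show "m = n" by (metis add_eq_iff add_0)
  qed
  then show ?thesis by (simp add: bij_def finite_UNIV_inj_surj)
qed

section \<open>Fibres and kernels of the additive maps
  \<open>x \<mapsto> f x + x \<star> m\<close>\<close>

definition fibre :: "'a \<Rightarrow> 'a \<Rightarrow> 'a set" where
  "fibre m k = {x. f x + x \<star> m = k}"

text \<open>A sign recording whether \<open>k\<close> lies in the image of
  \<open>x \<mapsto> f x + x \<star> m\<close>. That it is a character of the additive group is only
  shown in \<open>\<chi>_add\<close>.\<close>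

definition \<chi> :: "'a \<Rightarrow> 'a \<Rightarrow> int" where
  "\<chi> m k = (if fibre m k = {} then -1 else 1)"

lemma fibre_iff_line: "x \<in> fibre m k \<longleftrightarrow> Aff x (f x) \<in> slope_line star m k"
  by (auto simp: fibre_def slope_line_def add_eq_iff add.commute)

lemma fibre_0: "card (fibre 0 k) = 1"
proof -
  have "fibre 0 k = {inv_into UNIV f k}"
    using bij_f by (auto simp: fibre_def bij_is_inj surj_f_inv_f[OF bij_is_surj])
  then show ?thesis by simp
qed

text \<open>Two distinct nonzero kernel elements, together with 0, would give three hyperoval points
  on the line \<open>y = x \<star> m\<close>.\<close>

lemma kernel_le:
  assumes "x \<in> fibre m 0" "y \<in> fibre m 0" "x \<noteq> 0" "y \<noteq> 0"
  shows "x = y"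
proof (rule ccontr)
  assume ne: "x \<noteq> y"
  let ?l = "slope_line star m 0"
  have "0 \<in> fibre m 0" by (simp add: fibre_def)
  then have "Aff 0 (f 0) \<in> ?l" "Aff x (f x) \<in> ?l" "Aff y (f y) \<in> ?l"
    using assms by (auto simp: fibre_iff_line simp del: f_0)
  moreover have "?l \<in> plane_lines star" by (auto simp: plane_lines_def)
  ultimately have "collinear3 star (Aff 0 (f 0)) (Aff x (f x)) (Aff y (f y))"
    unfolding collinear3_def by blast
  moreover have "Aff z (f z) \<in> graph_oval f" for z by (auto simp: graph_oval_def)
  ultimately show False using hyperoval assms ne unfolding hyperoval_def
    by (metis point.inject(1))
qed

text \<open>Every \<open>x \<noteq> 0\<close> lies in the kernel for exactly one \<open>m \<noteq> 0\<close>, and no two share it; since there are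
  equally many \<open>x\<close> and \<open>m\<close>, every \<open>m \<noteq> 0\<close> is hit.\<close>

lemma kernel_card:
  assumes "m \<noteq> 0"
  shows "card (fibre m 0) = 2"
proof -
  define slope where "slope x = inv_into UNIV (\<lambda>m. x \<star> m) (f x)" for x
  have slope: "x \<star> slope x = f x" if "x \<noteq> 0" for x
    using bij_star_left[OF that] unfolding slope_def by (simp add: bij_is_surj surj_f_inv_f)
  then have ker: "x \<in> fibre (slope x) 0" if "x \<noteq> 0" for x
    using that by (simp add: fibre_def add_self)
  have "inj_on slope (UNIV - {0})"
    by (rule inj_onI) (metis ker kernel_le Diff_iff singletonI)
  moreover have "slope ` (UNIV - {0}) \<subseteq> UNIV - {0}"
  proof
    fix m assume "m \<in> slope ` (UNIV - {0})"
    then obtain x where "x \<noteq> 0" "m = slope x" by blast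
    then show "m \<in> UNIV - {0}" using slope[of x] f_eq_0_iff[of x] by auto
  qed
  ultimately have "slope ` (UNIV - {0}) = UNIV - {0}"
    by (intro endo_inj_surj) simp_all
  then have "m \<in> slope ` (UNIV - {0})" using assms by simp
  then obtain x where x: "x \<noteq> 0" "slope x = m" by auto
  then have "x \<in> fibre m 0" using ker by blast
  moreover have "0 \<in> fibre m 0" by (simp add: fibre_def)
  ultimately have "fibre m 0 = {0, x}" using kernel_le x by blast
  then show ?thesis using x by simp
qed

text \<open>A nonempty fibre is a coset of the kernel, which has two elements;
  \<open>1 + \<chi> m k\<close> is then 2 or 0. For \<open>m = 0\<close> every fibre has one element
  instead, so that slope is always treated separately.\<close>

lemma fibre_card:
  assumes "m \<noteq> 0"
  shows "int (card (fibre m k)) = 1 + \<chi> m k"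
proof (cases "fibre m k = {}")
  case False
  then obtain x where x: "x \<in> fibre m k" by blast
  have "fibre m k = (+) x ` fibre m 0"
  proof (intro equalityI subsetI)
    fix y assume "y \<in> fibre m k"
    then have "x + y \<in> fibre m 0"
      using x by (simp add: fibre_def f_add star_add_left) (metis add_self add.assoc add.commute)
    then show "y \<in> (+) x ` fibre m 0" by (metis add_self_left image_eqI)
  next
    fix y assume "y \<in> (+) x ` fibre m 0"
    then obtain z where z: "y = x + z" "f z + z \<star> m = 0" by (auto simp: fibre_def)
    have "f y + y \<star> m = (f x + x \<star> m) + (f z + z \<star> m)"
      by (simp add: z(1) f_add star_add_left algebra_simps)
    then show "y \<in> fibre m k" using x z by (simp add: fibre_def)
  qed
  then have "card (fibre m k) = card (fibre m 0)" by (simp add: card_image)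
  then show ?thesis using kernel_card[OF assms] False by (simp add: \<chi>_def)
qed (simp add: \<chi>_def)

section \<open>Values, row sums and multiplicativity of \<open>\<chi>\<close>\<close>

lemma \<chi>_0_left [simp]: "\<chi> 0 k = 1"
  using fibre_0[of k] by (auto simp: \<chi>_def)

lemma \<chi>_0_right [simp]: "\<chi> m 0 = 1"
proof -
  have "0 \<in> fibre m 0" by (simp add: fibre_def)
  then show ?thesis by (auto simp: \<chi>_def)
qed

lemma \<chi>_cases: "\<chi> m k = 1 \<or> \<chi> m k = -1"
  by (simp add: \<chi>_def)

lemma \<chi>_square [simp]: "\<chi> m k * \<chi> m k = 1"
  by (simp add: \<chi>_def)

lemma \<chi>_image [simp]: "\<chi> m (f x + x \<star> m) = 1"
  by (auto simp: \<chi>_def fibre_def)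

lemma sum_shift: "(\<Sum>k\<in>UNIV. F (k + d)) = (\<Sum>k\<in>UNIV. F (k::'a))"
  by (rule sum.reindex_bij_witness[of _ "\<lambda>k. k + d" "\<lambda>k. k + d"])
     (simp_all add: add.assoc add_self)

text \<open>The fibres over all \<open>k\<close> partition the field, so the \<open>q\<close> terms
  \<open>1 + \<chi> m k\<close> add up to \<open>q\<close>.\<close>

lemma \<chi>_row_sum:
  assumes "m \<noteq> 0"
  shows "(\<Sum>k\<in>UNIV. \<chi> m k) = 0"
proof -
  have "(\<Sum>k\<in>UNIV. card (fibre m k)) = card (\<Union>k\<in>UNIV. fibre m k)"
    by (rule card_UN_disjoint[symmetric]) (auto simp: fibre_def)
  also have "(\<Union>k\<in>UNIV. fibre m k) = UNIV" by (auto simp: fibre_def)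
  finally have "(\<Sum>k\<in>UNIV. int (card (fibre m k))) = int CARD('a)"
    by (metis of_nat_sum)
  then show ?thesis by (simp add: fibre_card[OF assms] sum.distrib)
qed

text \<open>The set where \<open>\<chi> m\<close> is 1 is the image of an additive map and hence
  closed under addition. Since \<open>k + (k + d) = d\<close>, adding an element \<open>k\<close> of
  it does not lead into it from outside either.\<close>

lemma \<chi>_in_subgroup: "\<chi> m k = 1 \<Longrightarrow> \<chi> m (k + d) = \<chi> m d"
proof -
  have shift: "\<chi> m (k + d) = 1" if kd: "\<chi> m k = 1" "\<chi> m d = 1" for k d
  proof -
    obtain x y where "k = f x + x \<star> m" "d = f y + y \<star> m"
      using kd by (auto simp: \<chi>_def fibre_def split: if_splits)
    then have "k + d = f (x + y) + (x + y) \<star> m"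
      by (simp add: f_add star_add_left algebra_simps)
    then show ?thesis by (metis \<chi>_image)
  qed
  assume k: "\<chi> m k = 1"
  then show ?thesis
    using shift[of k d] shift[of k "k + d"] \<chi>_cases[of m d] \<chi>_cases[of m "k + d"]
    by (auto simp: add_self_left)
qed

text \<open>For \<open>\<chi> m d = -1\<close>, the sum \<open>\<chi> m k + \<chi> m (k + d)\<close> is nowhere positive and has total 0, so it vanishes
  identically; this is the statement that the image has index 2.\<close>

lemma \<chi>_add: "\<chi> m (k + d) = \<chi> m k * \<chi> m d"
proof (cases "\<chi> m d = 1")
  case True
  then show ?thesis using \<chi>_in_subgroup[of m d k] by (simp add: add.commute)
next
  case False
  then have d: "\<chi> m d = -1" and m: "m \<noteq> 0" using \<chi>_cases[of m d] by auto
  have le: "\<chi> m k + \<chi> m (k + d) \<le> 0" for k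
    using \<chi>_in_subgroup[of m k d] d \<chi>_cases[of m k] \<chi>_cases[of m "k + d"] by auto
  have "(\<Sum>k\<in>UNIV. \<chi> m k + \<chi> m (k + d)) = 0"
    using m by (simp add: sum.distrib sum_shift[of "\<chi> m"] \<chi>_row_sum)
  then have "(\<Sum>k\<in>UNIV. - (\<chi> m k + \<chi> m (k + d))) = 0" by (simp only: sum_negf)
  then have "\<chi> m k + \<chi> m (k + d) = 0"
    using sum_nonneg_eq_0_iff[of UNIV "\<lambda>k. - (\<chi> m k + \<chi> m (k + d))"] le
    by (metis (no_types, lifting) finite UNIV_I neg_0_le_iff_le neg_equal_0_iff_equal)
  then show ?thesis using d by simp
qed

section \<open>Orthogonality relations and vanishing autocorrelation\<close>

lemma \<chi>_column_sum:
  "(\<Sum>m\<in>UNIV. \<chi> m d) = (if d = 0 then int CARD('a) else 0)"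
proof (cases "d = 0")
  case False
  \<comment> \<open>Double counting of the pairs \<open>(x, m)\<close> with
    \<open>f x + x \<star> m = d\<close>: each \<open>x \<noteq> 0\<close> has exactly one
    \<open>m\<close>, because \<open>m \<mapsto> x \<star> m\<close> is bijective, while
    \<open>x = 0\<close> has none since \<open>d \<noteq> 0\<close>.\<close>
  have "(\<Sum>m\<in>UNIV. card (fibre m d)) = (\<Sum>m\<in>UNIV. \<Sum>x\<in>UNIV. if f x + x \<star> m = d then 1 else 0)"
    by (simp add: fibre_def sum.If_cases)
  also have "\<dots> = (\<Sum>x\<in>UNIV. \<Sum>m\<in>UNIV. if f x + x \<star> m = d then 1 else 0)"
    by (rule sum.swap)
  also have "\<dots> = (\<Sum>x\<in>(UNIV::'a set). if x = 0 then 0 else 1)"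
  proof (rule sum.cong[OF refl])
    fix x
    show "(\<Sum>m\<in>UNIV. if f x + x \<star> m = d then 1 else 0) = (if x = 0 then 0 else 1 :: nat)"
    proof (cases "x = 0")
      case False
      obtain n where "x \<star> n = f x + d"
        using bij_is_surj[OF bij_star_left[OF False]] by (metis surjD)
      then have "f x + x \<star> m = d \<longleftrightarrow> m = n" for m
        using bij_is_inj[OF bij_star_left[OF False]] by (metis add_self_left injD)
      then have "{m. f x + x \<star> m = d} = {n}" by simp
      then show ?thesis using False by (simp add: sum.If_cases)
    qed (use \<open>d \<noteq> 0\<close> in simp)
  qed
  also have "\<dots> = CARD('a) - 1"
    by (simp add: sum.If_cases Compl_eq_Diff_UNIV card_Diff_singleton)
  finally have "(\<Sum>m\<in>UNIV. int (card (fibre m d))) = int CARD('a) - 1"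
    by (simp add: of_nat_diff flip: of_nat_sum)
  \<comment> \<open>The slope 0 contributes 1 to the count \<open>q - 1\<close>; the other
    \<open>q - 1\<close> slopes contribute \<open>1 + \<chi> m d\<close> each, so their characters
    sum to -1, which cancels \<open>\<chi> 0 d = 1\<close>.\<close>
  then have "int (card (fibre 0 d)) + (\<Sum>m\<in>UNIV - {0}. int (card (fibre m d))) = int CARD('a) - 1"
    using sum.remove[of UNIV "0::'a" "\<lambda>m. int (card (fibre m d))"] by simp
  then have "(\<Sum>m\<in>UNIV - {0}. 1 + \<chi> m d) = int CARD('a) - 2"
    by (simp add: fibre_0 fibre_card)
  then have "(\<Sum>m\<in>UNIV - {0}. \<chi> m d) = -1"
    by (simp add: sum.distrib card_Diff_singleton of_nat_diff)
  then show ?thesis using False sum.remove[of UNIV "0::'a" "\<lambda>m. \<chi> m d"] by simp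
qed simp

text \<open>A product of two characters is a character: either it is trivial, or translating by some
  \<open>d\<close> where it is -1 shows that its sum equals its own negative. Only the sign of the
  sum is kept for the next argument.\<close>

lemma \<chi>_prod_sum_nonneg: "0 \<le> (\<Sum>k\<in>UNIV. \<chi> m k * \<chi> n k)"
proof (cases "\<forall>k. \<chi> m k * \<chi> n k = 1")
  case False
  then obtain d where d: "\<chi> m d * \<chi> n d = -1" using \<chi>_cases[of m] \<chi>_cases[of n]
    by (metis mult.left_neutral mult_minus_left mult_cancel_left2 minus_mult_minus)
  have "(\<Sum>k\<in>UNIV. \<chi> m k * \<chi> n k) = (\<Sum>k\<in>UNIV. \<chi> m (k + d) * \<chi> n (k + d))"
    by (rule sum_shift[symmetric])
  also have "\<dots> = (\<Sum>k\<in>UNIV. (\<chi> m d * \<chi> n d) * (\<chi> m k * \<chi> n k))"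
    by (simp only: \<chi>_add mult_ac)
  also have "\<dots> = - (\<Sum>k\<in>UNIV. \<chi> m k * \<chi> n k)"
    by (simp add: d sum_negf)
  finally show ?thesis by simp
qed simp

text \<open>By the column sums, the inner products of row \<open>m\<close> with all rows add up to
  \<open>q\<close>. Row \<open>m\<close> itself already contributes \<open>q\<close>, and the
  remaining terms are nonnegative with sum 0.\<close>

lemma \<chi>_row_orthogonal:
  assumes "m \<noteq> n"
  shows "(\<Sum>k\<in>UNIV. \<chi> m k * \<chi> n k) = 0"
proof -
  let ?N = "\<lambda>n. \<Sum>k\<in>UNIV. \<chi> m k * \<chi> n k"
  have "(\<Sum>n\<in>UNIV. ?N n) = (\<Sum>k\<in>UNIV. \<chi> m k * (\<Sum>n\<in>UNIV. \<chi> n k))"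
    by (subst sum.swap) (simp add: sum_distrib_left)
  also have "\<dots> = (\<Sum>k\<in>(UNIV::'a set). if k = 0 then int CARD('a) else 0)"
    by (rule sum.cong) (auto simp: \<chi>_column_sum)
  finally have "(\<Sum>n\<in>UNIV. ?N n) = int CARD('a)" by simp
  then have "(\<Sum>n\<in>UNIV - {m}. ?N n) = 0" using sum.remove[of UNIV m ?N] by simp
  then show ?thesis
    using sum_nonneg_eq_0_iff[of "UNIV - {m}" ?N] \<chi>_prod_sum_nonneg assms by simp
qed

text \<open>Multiplicativity pulls out \<open>\<chi> (m + c) d\<close>. For
  \<open>c \<noteq> 0\<close> the inner sums vanish by row orthogonality; for \<open>c = 0\<close>
  they all equal \<open>q\<close>, and the column sum at \<open>d \<noteq> 0\<close>
  vanishes.\<close>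

lemma \<chi>_autocorrelation:
  assumes "(c, d) \<noteq> (0, 0)"
  shows "(\<Sum>m\<in>UNIV. \<Sum>k\<in>UNIV. \<chi> m k * \<chi> (m + c) (k + d)) = 0"
proof -
  have "(\<Sum>m\<in>UNIV. \<Sum>k\<in>UNIV. \<chi> m k * \<chi> (m + c) (k + d))
      = (\<Sum>m\<in>UNIV. \<chi> (m + c) d * (\<Sum>k\<in>UNIV. \<chi> m k * \<chi> (m + c) k))"
    by (simp add: \<chi>_add sum_distrib_left mult_ac)
  also have "\<dots> = 0"
  proof (cases "c = 0")
    case True
    then show ?thesis using assms by (simp add: \<chi>_column_sum flip: sum_distrib_right)
  next
    case False
    then show ?thesis by (simp add: \<chi>_row_orthogonal)
  qed
  finally show ?thesis .
qed

section \<open>Counting the level sets of \<open>\<chi>\<close> and their shifts\<close>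

lemma \<chi>_total: "(\<Sum>m\<in>UNIV. \<Sum>k\<in>UNIV. \<chi> m k) = int CARD('a)"
  by (subst sum.swap) (simp add: \<chi>_column_sum)

lemma \<chi>_total_shift: "(\<Sum>m\<in>UNIV. \<Sum>k\<in>UNIV. \<chi> (m + c) (k + d)) = int CARD('a)"
proof -
  have "(\<Sum>m\<in>UNIV. \<Sum>k\<in>UNIV. \<chi> (m + c) (k + d)) = (\<Sum>m\<in>UNIV. \<Sum>k\<in>UNIV. \<chi> (m + c) k)"
    by (simp only: sum_shift[of "\<chi> (m + c)" d for m])
  also have "\<dots> = (\<Sum>m\<in>UNIV. \<Sum>k\<in>UNIV. \<chi> m k)"
    by (rule sum_shift[of "\<lambda>m. \<Sum>k\<in>UNIV. \<chi> m k"])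
  finally show ?thesis by (simp add: \<chi>_total)
qed

lemma card_prod_UNIV: "int (card {(m, k). P m k}) = (\<Sum>m\<in>UNIV. \<Sum>k\<in>UNIV. of_bool (P m k))"
  for P :: "'a \<Rightarrow> 'a \<Rightarrow> bool"
proof -
  have "{(m, k). P m k} = (SIGMA m:UNIV. {k. P m k})" by auto
  then show ?thesis by simp
qed

text \<open>Summation of the indicator \<open>(1 + e * \<chi> m k) / 2\<close>, cleared of its
  denominator. The value \<open>e = 1\<close> serves the secants, \<open>e = -1\<close> the
  complement.\<close>

lemma card_level:
  assumes "e = 1 \<or> e = -1"
  shows "2 * int (card {(m, k). \<chi> m k = e}) = int CARD('a)^2 + e * int CARD('a)"
proof -
  have indicator: "2 * of_bool (\<chi> m k = e) = 1 + e * \<chi> m k" for m k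
    using assms \<chi>_cases[of m k] by auto
  have "2 * int (card {(m, k). \<chi> m k = e}) = (\<Sum>m\<in>UNIV. \<Sum>k\<in>UNIV. 1 + e * \<chi> m k)"
    by (simp only: card_prod_UNIV sum_distrib_left indicator)
  then show ?thesis
    by (simp add: sum.distrib power2_eq_square \<chi>_total flip: sum_distrib_left)
qed

lemma card_level_shift:
  assumes "e = 1 \<or> e = -1" and "(c, d) \<noteq> (0, 0)"
  shows "4 * int (card {(m, k). \<chi> m k = e \<and> \<chi> (m + c) (k + d) = e})
    = int CARD('a)^2 + 2 * e * int CARD('a)"
proof -
  \<comment> \<open>Product of the two indicators \<open>(1 + e * \<chi>) / 2\<close>, with
    \<open>e * e = 1\<close>; its last term sums to the autocorrelation.\<close>
  have indicator: "4 * of_bool (\<chi> m k = e \<and> \<chi> (m + c) (k + d) = e)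
      = 1 + e * \<chi> m k + e * \<chi> (m + c) (k + d) + \<chi> m k * \<chi> (m + c) (k + d)" for m k
    using assms(1) \<chi>_cases[of m k] \<chi>_cases[of "m + c" "k + d"] by auto
  have "4 * int (card {(m, k). \<chi> m k = e \<and> \<chi> (m + c) (k + d) = e})
     = (\<Sum>m\<in>UNIV. \<Sum>k\<in>UNIV. 1 + e * \<chi> m k + e * \<chi> (m + c) (k + d) + \<chi> m k * \<chi> (m + c) (k + d))"
    by (simp only: card_prod_UNIV sum_distrib_left indicator)
  then show ?thesis
    by (simp add: sum.distrib power2_eq_square \<chi>_total \<chi>_total_shift \<chi>_autocorrelation[OF assms(2)]
        flip: sum_distrib_left)
qed


section \<open>The action on lines\<close>

definition line :: "'a \<times> 'a \<Rightarrow> 'a point set" where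
  "line = (\<lambda>(m, k). slope_line star m k)"

text \<open>Normal form for the elements of \<open>\<Sigma>\<close>; their composition law is of
  Heisenberg type, twisted by the term \<open>u' \<star> c\<close>.\<close>

definition elation :: "'a \<Rightarrow> 'a \<Rightarrow> 'a \<Rightarrow> 'a point \<Rightarrow> 'a point" where
  "elation u v c = translation u v \<circ> shear star c"

lemma elation_simps [simp]:
  "elation u v c (Aff x y) = Aff (x + u) (y + x \<star> c + v)"
  "elation u v c (Slope z) = Slope (z + c)"
  "elation u v c Infty = Infty"
  by (simp_all add: elation_def)

lemma elation_0: "elation 0 0 0 = id"
proof
  show "elation 0 0 0 P = id P" for P by (cases P) simp_all
qed

lemma elation_comp:
  "elation u v c \<circ> elation u' v' c' = elation (u + u') (v + v' + u' \<star> c) (c + c')"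
proof
  show "(elation u v c \<circ> elation u' v' c') P = elation (u + u') (v + v' + u' \<star> c) (c + c') P" for P
    by (cases P) (simp_all add: star_add_left star_add_right algebra_simps)
qed

lemma elation_inverse:
  "elation u v c \<circ> elation u (v + u \<star> c) c = id"
  "elation u (v + u \<star> c) c \<circ> elation u v c = id"
  by (simp_all add: elation_comp add_self add_self_left add.assoc elation_0)

lemma elation_eq_iff:
  "elation u v c = elation u' v' c' \<longleftrightarrow> u = u' \<and> v = v' \<and> c = c'"
proof
  assume eq: "elation u v c = elation u' v' c'"
  show "u = u' \<and> v = v' \<and> c = c'"
    using fun_cong[OF eq, of "Aff 0 0"] fun_cong[OF eq, of "Slope 0"] by simp
qed simp

lemma bij_elation: "bij (elation u v c)"
  using elation_inverse o_bij by blast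

lemma subgroup_elations: "subgroup {elation u v c | u v c. True} (BijGroup UNIV)"
proof (rule subgroup_BijGroup_UNIV_I)
  show "\<exists>h\<in>{elation u v c | u v c. True}. g \<circ> h = id \<and> h \<circ> g = id"
    if "g \<in> {elation u v c | u v c. True}" for g
    using that elation_inverse by blast
qed (auto simp: elation_comp elation_eq_iff)

text \<open>The elations form a subgroup containing all generators, and each of them is a
  translation composed with a shear.\<close>

lemma Sigma_group_eq: "Sigma_group star = {elation u v c | u v c. True}"
proof -
  interpret BG: group "BijGroup (UNIV :: 'a point set)" by (rule group_BijGroup)
  let ?S = "{translation a b | a b. True} \<union> range (shear star)"
  have tr: "translation u v = elation u v 0" for u v
  proof
    show "translation u v P = elation u v 0 P" for P by (cases P) simp_all
  qed
  have sh: "shear star c = elation 0 0 c" for c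
  proof
    show "shear star c P = elation 0 0 c P" for P by (cases P) simp_all
  qed
  have "generate (BijGroup UNIV) ?S \<subseteq> {elation u v c | u v c. True}"
    by (rule BG.generate_subgroup_incl[OF _ subgroup_elations]) (auto simp: tr sh)
  moreover have "elation u v c \<in> generate (BijGroup UNIV) ?S" for u v c
  proof -
    have "translation u v \<in> ?S" "shear star c \<in> ?S" by auto
    then have "translation u v \<otimes>\<^bsub>BijGroup UNIV\<^esub> shear star c \<in> generate (BijGroup UNIV) ?S"
      by (intro generate.eng generate.incl)
    then show ?thesis
      using bij_elation[of u v 0] bij_elation[of 0 0 c]
      by (simp only: BijGroup_UNIV_mult elation_def[of u v c] tr[symmetric] sh[symmetric])
  qed
  ultimately show ?thesis unfolding Sigma_group_def by auto
qed

lemma inj_line: "inj line"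
proof (rule injI)
  fix p p' assume eq: "line p = line p'"
  obtain m k m' k' where p: "p = (m, k)" "p' = (m', k')" by fastforce
  have "Slope m \<in> line p" "Aff 0 k \<in> line p" by (auto simp: line_def slope_line_def p)
  then show "p = p'" unfolding eq by (auto simp: line_def slope_line_def p)
qed

text \<open>One inclusion is a computation valid for all parameters; the other follows by applying
  it to the inverse elation.\<close>

lemma elation_line:
  "elation u v c ` line (m, k) = line (m + c, k + v + u \<star> (m + c))"
proof -
  have sub: "elation u v c ` line (m, k) \<subseteq> line (m + c, k + v + u \<star> (m + c))" for u v c m k
    by (auto simp: line_def slope_line_def star_add_left star_add_right add.assoc add.left_commute
        add_self add_self_left add.commute)
  have "line (m + c, k + v + u \<star> (m + c)) \<subseteq> elation u v c ` line (m, k)"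
  proof
    fix P assume "P \<in> line (m + c, k + v + u \<star> (m + c))"
    then have "elation u (v + u \<star> c) c P
        \<in> line (m + c + c, k + v + u \<star> (m + c) + (v + u \<star> c) + u \<star> (m + c + c))"
      using sub by blast
    moreover have "m + c + c = m" by (simp add: add.assoc add_self)
    moreover have "k + v + u \<star> (m + c) + (v + u \<star> c) + u \<star> m = k"
      by (simp add: star_add_right add.assoc add.left_commute add_self add_self_left add.commute)
    ultimately have "elation u (v + u \<star> c) c P \<in> line (m, k)" by (simp only:)
    then have "elation u v c (elation u (v + u \<star> c) c P) \<in> elation u v c ` line (m, k)" by simp
    then show "P \<in> elation u v c ` line (m, k)"
      using fun_cong[OF elation_inverse(1), of u v c P] by simp
  qed
  with sub show ?thesis by blast
qed

text \<open>The intercept shift \<open>u \<star> (m + c)\<close> depends on \<open>m\<close>, but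
  differs from the constant \<open>f u\<close> by an element of the image, where
  \<open>\<chi> (m + c)\<close> is 1. Hence inside \<open>\<chi>\<close> an elation acts as a plain
  shift of \<open>(m, k)\<close>.\<close>

lemma \<chi>_elation: "\<chi> (m + c) (k + v + u \<star> (m + c)) = \<chi> (m + c) (k + (v + f u))"
proof -
  have "k + v + u \<star> (m + c) = k + (v + f u) + (f u + u \<star> (m + c))"
    by (simp add: add.assoc add_self_left)
  then show ?thesis by (simp only: \<chi>_add[of _ "k + (v + f u)"] \<chi>_image mult_1_right)
qed

lemma line_inter_oval: "card (line (m, k) \<inter> graph_oval f) = 2 \<longleftrightarrow> \<chi> m k = 1"
proof -
  have eq: "line (m, k) \<inter> graph_oval f
      = (\<lambda>x. Aff x (f x)) ` fibre m k \<union> (if m = 0 then {Slope 0} else {})"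
    by (auto simp: line_def fibre_iff_line graph_oval_def) (auto simp: slope_line_def)
  have card: "card ((\<lambda>x. Aff x (f x)) ` fibre m k) = card (fibre m k)"
    by (rule card_image) (auto simp: inj_on_def)
  show ?thesis
  \<comment> \<open>A line of slope 0 always meets the hyperoval in \<open>Slope 0\<close> and one
    affine point, matching \<open>\<chi> 0 k = 1\<close>; any other line meets it only in affine
    points, 0 or 2 of them.\<close>
  proof (cases "m = 0")
    case True
    then have "card (line (m, k) \<inter> graph_oval f) = Suc (card ((\<lambda>x. Aff x (f x)) ` fibre m k))"
      unfolding eq by (simp add: card_insert_if image_iff)
    then show ?thesis using True fibre_0 card by simp
  next
    case False
    then show ?thesis using fibre_card[OF False, of k] \<chi>_cases[of m k] eq card by auto
  qed
qed

section \<open>Design points, and blocks as shifted level sets\<close>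

lemma design_points_eq: "design_points star = range line"
  by (auto simp: design_points_def plane_lines_def line_def slope_line_def line_at_infinity_def
      vertical_line_def image_iff)

lemma card_design_points: "card (design_points star) = CARD('a)^2"
  unfolding design_points_eq
  by (simp add: card_image[OF inj_line] card_prod power2_eq_square)

lemma secants_diff:
  "secants star H - lines_through_infty star = {l \<in> design_points star. card (l \<inter> H) = 2}"
  by (auto simp: secants_def lines_through_infty_def design_points_def)

definition block :: "'a \<Rightarrow> 'a \<Rightarrow> 'a point set set" where
  "block c d = line ` {(m, k). \<chi> (m + c) (k + d) = 1}"

lemma block_subset: "block c d \<subseteq> design_points star"
  by (auto simp: block_def design_points_eq)

text \<open>Pulling a line back along the elation reduces to secants of the original hyperoval. The
  block depends on \<open>u\<close> and \<open>v\<close> only through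
  \<open>v + f u + u \<star> c\<close>, so the three parameters collapse to two.\<close>

lemma secants_elation:
  "secants star (elation u v c ` graph_oval f) - lines_through_infty star
    = block c (v + f u + u \<star> c)"
proof -
  have "card (line (m, k) \<inter> elation u v c ` graph_oval f) = 2
      \<longleftrightarrow> \<chi> (m + c) (k + (v + f u + u \<star> c)) = 1" for m k
  proof -
    have c: "m + c + c = m" by (simp add: add.assoc add_self)
    have "line (m, k) = elation u v c ` line (m + c, k + v + u \<star> m)"
      unfolding elation_line c by (simp add: add.assoc add.left_commute add_self)
    then have "line (m, k) \<inter> elation u v c ` graph_oval f
        = elation u v c ` (line (m + c, k + v + u \<star> m) \<inter> graph_oval f)"
      by (simp add: image_Int[OF bij_is_inj[OF bij_elation]])
    then have "card (line (m, k) \<inter> elation u v c ` graph_oval f)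
        = card (line (m + c, k + v + u \<star> m) \<inter> graph_oval f)"
      by (simp add: card_image inj_on_subset[OF bij_is_inj[OF bij_elation]])
    moreover have k: "k + v + u \<star> m = k + (v + u \<star> c) + u \<star> (m + c)"
      by (simp add: star_add_right add.assoc add.left_commute add_self)
    have "\<chi> (m + c) (k + v + u \<star> m) = \<chi> (m + c) (k + (v + f u + u \<star> c))"
      unfolding k \<chi>_elation by (simp only: ac_simps)
    ultimately show ?thesis by (simp only: line_inter_oval)
  qed
  then show ?thesis
    unfolding secants_diff design_points_eq block_def by auto
qed

lemma secants_graph_oval:
  "secants star (graph_oval f) - lines_through_infty star = block 0 0"
  using secants_elation[of 0 0 0] by (simp add: elation_0)

lemma design_blocks_eq: "design_blocks star (graph_oval f) = (\<lambda>(c, d). block c d) ` UNIV"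
proof -
  have orbit: "oval_orbit star (graph_oval f) = (\<lambda>(u, v, c). elation u v c ` graph_oval f) ` UNIV"
    by (auto simp: oval_orbit_def Sigma_group_eq)
  have blocks: "design_blocks star (graph_oval f) = (\<lambda>(u, v, c). block c (v + f u + u \<star> c)) ` UNIV"
    unfolding design_blocks_def orbit Setcompr_eq_image Collect_mem_eq
    by (simp add: image_image case_prod_unfold secants_elation)
  show ?thesis
  proof (intro equalityI subsetI)
    fix b assume "b \<in> design_blocks star (graph_oval f)"
    then show "b \<in> (\<lambda>(c, d). block c d) ` UNIV" unfolding blocks by auto
  next
    fix b assume "b \<in> (\<lambda>(c, d). block c d) ` UNIV"
    then obtain c d where "b = block c d" by auto
    then show "b \<in> design_blocks star (graph_oval f)"
      \<comment> \<open>With \<open>u = 0\<close> the shift \<open>v + f u + u \<star> c\<close> is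
        just \<open>v\<close>, so every pair \<open>(c, d)\<close> occurs.\<close>
      unfolding blocks by (intro image_eqI[of _ _ "(0, d, c)"]) simp_all
  qed
qed

section \<open>Sizes of blocks and of their intersections\<close>

lemma line_in_image: "line (m, k) \<in> line ` {(m, k). P m k} \<longleftrightarrow> P m k"
  by (simp add: inj_image_mem_iff[OF inj_line])

lemma card_line_image: "card (line ` A) = card A"
  by (rule card_image[OF inj_on_subset[OF inj_line]]) simp

lemma card_Collect_shift:
  "card {(m, k). P (m + c) (k + d)} = card {(m, k). P m k}" for P :: "'a \<Rightarrow> 'a \<Rightarrow> bool"
proof -
  have "bij_betw (\<lambda>(m, k). (m + c, k + d)) {(m, k). P (m + c) (k + d)} {(m, k). P m k}"
    by (rule bij_betw_byWitness[where f' = "\<lambda>(m, k). (m + c, k + d)"])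
       (auto simp: add.assoc add_self)
  then show ?thesis by (rule bij_betw_same_card)
qed

lemma card_block: "2 * int (card (block c d)) = int CARD('a)^2 + int CARD('a)"
  using card_level[of 1] card_Collect_shift[of "\<lambda>m k. \<chi> m k = 1" c d]
  by (simp add: block_def card_line_image)

lemma card_block_Int:
  assumes "(c, d) \<noteq> (c', d')"
  shows "4 * int (card (block c d \<inter> block c' d')) = int CARD('a)^2 + 2 * int CARD('a)"
proof -
  \<comment> \<open>Translating the index pair by \<open>(c, d)\<close> moves the first block to the
    unshifted one, so only the difference of the two shifts matters; in characteristic 2 it is
    \<open>(c + c', d + d')\<close>.\<close>
  let ?P = "\<lambda>m k. \<chi> m k = 1 \<and> \<chi> (m + (c + c')) (k + (d + d')) = 1"
  have "block c d \<inter> block c' d'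
      = line ` ({(m, k). \<chi> (m + c) (k + d) = 1} \<inter> {(m, k). \<chi> (m + c') (k + d') = 1})"
    unfolding block_def image_Int[OF inj_line] ..
  also have "{(m, k). \<chi> (m + c) (k + d) = 1} \<inter> {(m, k). \<chi> (m + c') (k + d') = 1}
      = {(m, k). ?P (m + c) (k + d)}"
    by (simp add: add.assoc add_self_left Collect_conj_eq[symmetric] case_prod_unfold)
  finally have "card (block c d \<inter> block c' d') = card {(m, k). ?P (m + c) (k + d)}"
    by (simp only: card_line_image)
  also have "\<dots> = card {(m, k). ?P m k}"
    by (rule card_Collect_shift[of ?P])
  finally have "card (block c d \<inter> block c' d') = card {(m, k). ?P m k}" .
  moreover have "(c + c', d + d') \<noteq> (0, 0)" using assms by (simp add: add_eq_iff)
  ultimately show ?thesis using card_level_shift[of 1 "c + c'" "d + d'"] by simp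
qed

lemma quarter_half:
  shows "2 * int n = int CARD('a)^2 + int CARD('a) \<Longrightarrow> n = CARD('a)^2 div 2 + CARD('a) div 2"
    and "2 * int n = int CARD('a)^2 - int CARD('a) \<Longrightarrow> n = CARD('a)^2 div 2 - CARD('a) div 2"
    and "4 * int n = int CARD('a)^2 + 2 * int CARD('a) \<Longrightarrow> n = CARD('a)^2 div 4 + CARD('a) div 2"
    and "4 * int n = int CARD('a)^2 - 2 * int CARD('a) \<Longrightarrow> n = CARD('a)^2 div 4 - CARD('a) div 2"
proof -
  obtain r where r: "CARD('a) = 2 * r" using even_card by (elim evenE)
  then have eqs: "CARD('a)^2 div 2 = 2 * r^2" "CARD('a)^2 div 4 = r^2" "CARD('a) div 2 = r"
      "int CARD('a)^2 = 4 * int (r^2)" "int CARD('a) = 2 * int r"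
    by (simp_all add: power_mult_distrib)
  show "2 * int n = int CARD('a)^2 + int CARD('a) \<Longrightarrow> n = CARD('a)^2 div 2 + CARD('a) div 2"
    unfolding eqs(1-4) unfolding eqs(5) by linarith
  show "2 * int n = int CARD('a)^2 - int CARD('a) \<Longrightarrow> n = CARD('a)^2 div 2 - CARD('a) div 2"
    unfolding eqs(1-4) unfolding eqs(5) by linarith
  show "4 * int n = int CARD('a)^2 + 2 * int CARD('a) \<Longrightarrow> n = CARD('a)^2 div 4 + CARD('a) div 2"
    unfolding eqs(1-4) unfolding eqs(5) by linarith
  show "4 * int n = int CARD('a)^2 - 2 * int CARD('a) \<Longrightarrow> n = CARD('a)^2 div 4 - CARD('a) div 2"
    unfolding eqs(1-4) unfolding eqs(5) by linarith
qed

lemma symmetric_design: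
  "symmetric_design (design_points star) (design_blocks star (graph_oval f))
     (CARD('a)^2) (CARD('a)^2 div 2 + CARD('a) div 2) (CARD('a)^2 div 4 + CARD('a) div 2)"
proof -
  \<comment> \<open>If different parameters gave the same block, block size and intersection size
    would agree: \<open>2 * (q^2 + q) = q^2 + 2 * q\<close>, forcing \<open>q^2 = 0\<close>.\<close>
  have "inj (\<lambda>(c, d). block c d)"
  proof (rule injI, rule ccontr)
    fix p p' assume eq: "(\<lambda>(c, d). block c d) p = (\<lambda>(c, d). block c d) p'" and ne: "p \<noteq> p'"
    obtain c d c' d' where p: "p = (c, d)" "p' = (c', d')" by fastforce
    then have "(c, d) \<noteq> (c', d')" "block c d = block c' d'" using ne eq by simp_all
    then have "4 * int (card (block c d)) = int CARD('a)^2 + 2 * int CARD('a)"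
      using card_block_Int[of c d c' d'] by simp
    moreover have "int CARD('a)^2 \<noteq> 0" by simp
    ultimately show False using card_block[of c d] by linarith
  qed
  then have "card (design_blocks star (graph_oval f)) = CARD('a)^2"
    unfolding design_blocks_eq by (simp add: card_image card_prod power2_eq_square)
  moreover have "card b = CARD('a)^2 div 2 + CARD('a) div 2 \<and> b \<subseteq> design_points star"
    if b: "b \<in> design_blocks star (graph_oval f)" for b
  proof -
    obtain c d where "b = block c d" using b by (auto simp: design_blocks_eq)
    then show ?thesis using quarter_half(1)[OF card_block] block_subset by simp
  qed
  moreover have "card (b \<inter> b') = CARD('a)^2 div 4 + CARD('a) div 2"
    if b: "b \<in> design_blocks star (graph_oval f)" "b' \<in> design_blocks star (graph_oval f)" "b \<noteq> b'"
    for b b'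
  proof -
    obtain c d c' d' where "b = block c d" "b' = block c' d'" "(c, d) \<noteq> (c', d')"
      using b by (auto simp: design_blocks_eq)
    then show ?thesis using quarter_half(3)[OF card_block_Int] by blast
  qed
  ultimately show ?thesis
    unfolding symmetric_design_def
    by (simp add: card_design_points) (simp add: design_points_eq design_blocks_eq)
qed

section \<open>The difference sets in \<open>G1\<close> and \<open>G2\<close>\<close>

lemma card_elation_Int:
  assumes "e = 1 \<or> e = -1" and "elation u v c \<noteq> id" and "c = 0 \<longrightarrow> u = 0"
  shows "4 * int (card {l \<in> line ` {(m, k). \<chi> m k = e}. elation u v c ` l \<in> line ` {(m, k). \<chi> m k = e}})
    = int CARD('a)^2 + 2 * e * int CARD('a)"
proof -
  have "{l \<in> line ` {(m, k). \<chi> m k = e}. elation u v c ` l \<in> line ` {(m, k). \<chi> m k = e}}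
      = line ` {(m, k). \<chi> m k = e \<and> \<chi> (m + c) (k + (v + f u)) = e}"
  proof -
    have "{l \<in> line ` {(m, k). \<chi> m k = e}. elation u v c ` l \<in> line ` {(m, k). \<chi> m k = e}}
        = line ` {(m, k). \<chi> m k = e \<and> elation u v c ` line (m, k) \<in> line ` {(m, k). \<chi> m k = e}}"
      by auto
    then show ?thesis by (simp only: elation_line line_in_image \<chi>_elation)
  qed
  \<comment> \<open>The condition linking \<open>c\<close> and \<open>u\<close> enters here: it
    excludes the translations with \<open>c = 0\<close>, \<open>u \<noteq> 0\<close> and
    \<open>v = f u\<close>, whose effective shift is zero although they are not the
    identity.\<close>
  moreover have "(c, v + f u) \<noteq> (0, 0)"
    using assms(2,3) elation_0 by auto
  ultimately show ?thesis using card_level_shift[OF assms(1)] by (simp add: card_line_image)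
qed

text \<open>Treats both groups at once: in \<open>G1\<close> always \<open>u = 0\<close>, in
  \<open>G2\<close> always \<open>u = c\<close>. The complement is obtained from the level set of -1
  by the same count.\<close>

lemma difference_set_secant_elements:
  assumes sub: "subgroup G (BijGroup UNIV)"
    and elation: "\<And>g. g \<in> G \<Longrightarrow> \<exists>u v c. g = elation u v c \<and> (c = 0 \<longrightarrow> u = 0)"
    and reg: "bij_betw (\<lambda>g. g ` slope_line star 0 0) G (design_points star)"
  shows "difference_set (perm_group G) (secant_elements star (graph_oval f) G)
      (CARD('a)^2) (CARD('a)^2 div 2 + CARD('a) div 2) (CARD('a)^2 div 4 + CARD('a) div 2)" (is ?D)
    and "difference_set (perm_group G) (G - secant_elements star (graph_oval f) G)
      (CARD('a)^2) (CARD('a)^2 div 2 - CARD('a) div 2) (CARD('a)^2 div 4 - CARD('a) div 2)" (is ?C)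
proof -
  define B where "B e = line ` {(m, k). \<chi> m k = e}" for e
  have B: "B e \<subseteq> design_points star" for e by (auto simp: B_def design_points_eq)
  have fin: "finite (design_points star)" by (simp add: design_points_eq)
  have cardB: "2 * int (card (B e)) = int CARD('a)^2 + e * int CARD('a)" if "e = 1 \<or> e = -1" for e
    using card_level[OF that] by (simp add: B_def card_line_image)
  have cnt: "4 * int (card {l \<in> B e. g ` l \<in> B e}) = int CARD('a)^2 + 2 * e * int CARD('a)"
    if "e = 1 \<or> e = -1" "g \<in> G" "g \<noteq> id" for e g
    using elation[OF that(2)] card_elation_Int[OF that(1)] that(3) unfolding B_def by blast
  have sec: "secant_elements star (graph_oval f) G = {g \<in> G. g ` slope_line star 0 0 \<in> B 1}"
    by (simp add: secant_elements_def secants_graph_oval block_def B_def)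
  have compl: "B (-1) = design_points star - B 1"
    unfolding B_def design_points_eq image_set_diff[OF inj_line, symmetric]
    by (rule arg_cong[of _ _ "(`) line"]) (auto simp: \<chi>_def)
  have "G - secant_elements star (graph_oval f) G = {g \<in> G. g ` slope_line star 0 0 \<in> B (-1)}"
    unfolding sec compl using reg by (auto simp: bij_betw_def)
  moreover have
    "difference_set (perm_group G) {g \<in> G. g ` slope_line star 0 0 \<in> B (-1)}
      (CARD('a)^2) (card (B (-1))) (CARD('a)^2 div 4 - CARD('a) div 2)"
    unfolding card_design_points[symmetric]
    by (rule difference_set_regular_action[OF sub reg fin B],
        unfold card_design_points, rule quarter_half(4)) (use cnt[of "-1"] in simp)
  moreover have "card (B (-1)) = CARD('a)^2 div 2 - CARD('a) div 2"
    by (rule quarter_half(2)) (use cardB[of "-1"] in simp)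
  ultimately show ?C by simp
  have "difference_set (perm_group G) {g \<in> G. g ` slope_line star 0 0 \<in> B 1}
      (CARD('a)^2) (card (B 1)) (CARD('a)^2 div 4 + CARD('a) div 2)"
    unfolding card_design_points[symmetric]
    by (rule difference_set_regular_action[OF sub reg fin B],
        unfold card_design_points, rule quarter_half(3)) (use cnt[of 1] in simp)
  moreover have "card (B 1) = CARD('a)^2 div 2 + CARD('a) div 2"
    by (rule quarter_half(1)) (use cardB[of 1] in simp)
  ultimately show ?D unfolding sec by simp
qed

lemma G1_eq: "G1 star = {elation 0 b c | b c. True}"
  by (simp add: G1_def elation_def)

lemma G2_eq: "G2 star = {elation a b a | a b. True}"
  by (simp add: G2_def elation_def)

lemma subgroup_G1: "subgroup (G1 star) (BijGroup UNIV)"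
proof (rule subgroup_BijGroup_UNIV_I)
  show "\<exists>h\<in>G1 star. g \<circ> h = id \<and> h \<circ> g = id" if "g \<in> G1 star" for g
    using that elation_inverse unfolding G1_eq by blast
qed (auto simp: G1_eq elation_comp elation_eq_iff)

lemma subgroup_G2: "subgroup (G2 star) (BijGroup UNIV)"
proof (rule subgroup_BijGroup_UNIV_I)
  show "\<exists>h\<in>G2 star. g \<circ> h = id \<and> h \<circ> g = id" if "g \<in> G2 star" for g
    using that elation_inverse unfolding G2_eq by blast
qed (auto simp: G2_eq elation_comp elation_eq_iff)

lemma elation_line_0: "elation u v c ` slope_line star 0 0 = line (c, v + u \<star> c)"
  using elation_line[of u v c 0 0] by (simp add: line_def)

lemma regular_G1: "bij_betw (\<lambda>g. g ` slope_line star 0 0) (G1 star) (design_points star)"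
  unfolding bij_betw_def
proof
  show "inj_on (\<lambda>g. g ` slope_line star 0 0) (G1 star)"
    by (rule inj_onI) (auto simp: G1_eq elation_line_0 inj_eq[OF inj_line])
  have "line (m, k) \<in> (\<lambda>g. g ` slope_line star 0 0) ` G1 star" for m k
    by (rule image_eqI[of _ _ "elation 0 k m"]) (auto simp: G1_eq elation_line_0)
  then show "(\<lambda>g. g ` slope_line star 0 0) ` G1 star = design_points star"
    by (auto simp: design_points_eq) (auto simp: G1_eq elation_line_0)
qed

lemma regular_G2: "bij_betw (\<lambda>g. g ` slope_line star 0 0) (G2 star) (design_points star)"
  unfolding bij_betw_def
proof
  show "inj_on (\<lambda>g. g ` slope_line star 0 0) (G2 star)"
    by (rule inj_onI) (auto simp: G2_eq elation_line_0 inj_eq[OF inj_line])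
  have "line (m, k) \<in> (\<lambda>g. g ` slope_line star 0 0) ` G2 star" for m k
    \<comment> \<open>The image of the base line has intercept \<open>v + m \<star> m\<close>; the
      summand \<open>m \<star> m\<close> in the witness cancels it in characteristic 2.\<close>
    by (rule image_eqI[of _ _ "elation m (k + m \<star> m) m"])
       (auto simp: G2_eq elation_line_0 add.assoc add_self)
  then show "(\<lambda>g. g ` slope_line star 0 0) ` G2 star = design_points star"
    by (auto simp: design_points_eq) (auto simp: G2_eq elation_line_0)
qed

end

theorem theorem5p3:
  fixes star :: "'a::{finite,field} \<Rightarrow> 'a \<Rightarrow> 'a"
    and f :: "'a \<Rightarrow> 'a"
    and q :: nat
  assumes "q = CARD('a)"
    and "even q"
    and "presemifield star"
    and "bij f"
    and "\<And>x y. f (x + y) = f x + f y"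
    and "f 0 = 0"
    and "hyperoval star (graph_oval f)"
  shows "symmetric_design (design_points star) (design_blocks star (graph_oval f))
           (q^2) (q^2 div 2 + q div 2) (q^2 div 4 + q div 2) \<and>
         (\<forall>G \<in> {G1 star, G2 star}.
           difference_set (perm_group G) (secant_elements star (graph_oval f) G)
             (q^2) (q^2 div 2 + q div 2) (q^2 div 4 + q div 2) \<and>
           difference_set (perm_group G) (G - secant_elements star (graph_oval f) G)
             (q^2) (q^2 div 2 - q div 2) (q^2 div 4 - q div 2))"
proof -
  interpret additive_hyperoval star f
    by unfold_locales (use assms in auto)
  have G1: "\<exists>u v c. g = elation u v c \<and> (c = 0 \<longrightarrow> u = 0)" if "g \<in> G1 star" for g
    using that unfolding G1_eq by blast
  have G2: "\<exists>u v c. g = elation u v c \<and> (c = 0 \<longrightarrow> u = 0)" if "g \<in> G2 star" for g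
    using that unfolding G2_eq by blast
  show ?thesis
    using symmetric_design
      difference_set_secant_elements[OF subgroup_G1 G1 regular_G1]
      difference_set_secant_elements[OF subgroup_G2 G2 regular_G2]
    unfolding assms(1) by simp
qed

end
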